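(* Let $V_0$ be a real function of $r$, $d_9$ a real constant, and $$H=-\frac{\hbar^2}{2}\nabla^2+V_0(r)+\left(d_9-V_0(r)\right)(\vec\sigma_1,\vec\sigma_2)+\frac12(\vec\sigma_1,\vec p)(\vec\sigma_2,\vec p).$$ Let $K=(\vec\sigma_1,\vec\sigma_2)$ and $Y_P^{30}=\frac12(\vec\sigma_1+\vec\sigma_2,\vec p)$. Then $H,K,Y_P^{30}$, together with $\vec J^2$ and $J_3$, form a commuting set of integrals of motion: $$[H,\vec J^2]=[H,J_3]=[\vec J^2,J_3]=0,$$ $$[H,Y_P^{30}]=[H,K]=[K,Y_P^{30}]=[\vec J^2,Y_P^{30}]=[J_3,Y_P^{30}]=[\vec J^2,K]=[J_3,K]=0.$$ Moreover, $Y_P^{30}$ satisfies the quadratic relation $$(Y_P^{30})^2=\frac14(H-d_9)(K+3).$$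
   Context: $\vec x\in\mathbb R^3\setminus\{0\}$, $r=|\vec x|$, $p_k=-i\hbar\,\partial/\partial x_k$ with $\hbar>0$, $\vec L=\vec x\times\vec p$, $(\cdot,\cdot)$ is the Euclidean inner product; $\vec\sigma$ is the vector of Pauli matrices, $\vec\sigma_1=\vec\sigma\otimes I_2$, $\vec\sigma_2=I_2\otimes\vec\sigma$, $\vec J=\vec L+\frac\hbar2(\vec\sigma_1+\vec\sigma_2)$. Operators act on smooth $\mathbb C^4$-valued functions on $\mathbb R^3\setminus\{0\}$ ($V_0$ smooth). *)

theory Defs
  imports "HOL-Analysis.Analysis" "HOL-Library.Function_Algebras"
begin

fun times_differentiable_on ::
  "nat \<Rightarrow> 'a::real_normed_vector set \<Rightarrow> ('a \<Rightarrow> 'b::real_normed_vector) \<Rightarrow> bool" where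
  "times_differentiable_on 0 S f \<longleftrightarrow> continuous_on S f"
| "times_differentiable_on (Suc n) S f \<longleftrightarrow>
     (\<forall>x\<in>S. f differentiable (at x)) \<and>
     (\<forall>v. times_differentiable_on n S (\<lambda>x. frechet_derivative f (at x) v))"

text \<open>Intended for open \<open>S\<close>.\<close>
definition smooth_on :: "'a::real_normed_vector set \<Rightarrow> ('a \<Rightarrow> 'b::real_normed_vector) \<Rightarrow> bool" where
  "smooth_on S f \<longleftrightarrow> (\<forall>n. times_differentiable_on n S f)"

text \<open>Wave functions take values in the space of functions on a product of two two-element index
  types, i.e. in the tensor product of two copies of \<open>complex ^ 2\<close>, which has dimension 4.
  They are total functions on \<open>real ^ 3\<close>, but their values at the origin are irrelevant: see
  \<open>op_eq\<close> below.\<close>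
type_synonym wave = "real ^ 3 \<Rightarrow> complex ^ (2 \<times> 2)"
type_synonym oper = "wave \<Rightarrow> wave"

text \<open>Addition, subtraction and zero of operators are the pointwise ones of
  \<^theory>\<open>HOL-Library.Function_Algebras\<close>; the product of operators is composition
  (which binds weaker than addition).\<close>

definition op_eq :: "oper \<Rightarrow> oper \<Rightarrow> bool" (infix "\<approx>" 50) where
  "A \<approx> B \<longleftrightarrow> (\<forall>\<psi>. smooth_on (- {0}) \<psi> \<longrightarrow> (\<forall>x\<in>- {0}. A \<psi> x = B \<psi> x))"

definition op_scale :: "real \<Rightarrow> oper \<Rightarrow> oper" where
  "op_scale c A = (\<lambda>\<psi> x. c *\<^sub>R A \<psi> x)"

definition commutator :: "oper \<Rightarrow> oper \<Rightarrow> oper" where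
  "commutator A B = (A \<circ> B) - (B \<circ> A)"

definition op_inner :: "(3 \<Rightarrow> oper) \<Rightarrow> (3 \<Rightarrow> oper) \<Rightarrow> oper" where
  "op_inner A B = (\<Sum>k\<in>UNIV. A k \<circ> B k)"

definition op_cross :: "(3 \<Rightarrow> oper) \<Rightarrow> (3 \<Rightarrow> oper) \<Rightarrow> 3 \<Rightarrow> oper" where
  "op_cross A B k =
     (if k = 1 then (A 2 \<circ> B 3) - (A 3 \<circ> B 2)
      else if k = 2 then (A 3 \<circ> B 1) - (A 1 \<circ> B 3)
      else (A 1 \<circ> B 2) - (A 2 \<circ> B 1))"

definition mult_op :: "(real ^ 3 \<Rightarrow> real) \<Rightarrow> oper" where
  "mult_op f = (\<lambda>\<psi> x. f x *\<^sub>R \<psi> x)"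

definition matrix_op :: "complex ^ (2 \<times> 2) ^ (2 \<times> 2) \<Rightarrow> oper" where
  "matrix_op M = (\<lambda>\<psi> x. M *v \<psi> x)"

definition partial :: "3 \<Rightarrow> oper" where
  "partial k = (\<lambda>\<psi> x. frechet_derivative \<psi> (at x) (axis k 1))"

definition laplacian :: oper where
  "laplacian = (\<Sum>k\<in>UNIV. partial k \<circ> partial k)"

definition position :: "3 \<Rightarrow> oper" where
  "position k = mult_op (\<lambda>x. x $ k)"

definition momentum :: "real \<Rightarrow> 3 \<Rightarrow> oper" where
  "momentum hbar k = (\<lambda>\<psi> x. (- \<i> * complex_of_real hbar) *s partial k \<psi> x)"

definition orbital :: "real \<Rightarrow> 3 \<Rightarrow> oper" where
  "orbital hbar = op_cross position (momentum hbar)"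

definition pauli :: "3 \<Rightarrow> complex ^ 2 ^ 2" where
  "pauli k =
     (if k = 1 then vector [vector [0, 1], vector [1, 0]]
      else if k = 2 then vector [vector [0, - \<i>], vector [\<i>, 0]]
      else vector [vector [1, 0], vector [0, - 1]])"

definition kronecker ::
  "complex ^ 2 ^ 2 \<Rightarrow> complex ^ 2 ^ 2 \<Rightarrow> complex ^ (2 \<times> 2) ^ (2 \<times> 2)" where
  "kronecker A B = (\<chi> i j. A $ fst i $ fst j * B $ snd i $ snd j)"

definition sigma1 :: "3 \<Rightarrow> oper" where
  "sigma1 k = matrix_op (kronecker (pauli k) (mat 1))"

definition sigma2 :: "3 \<Rightarrow> oper" where
  "sigma2 k = matrix_op (kronecker (mat 1) (pauli k))"

definition total_J :: "real \<Rightarrow> 3 \<Rightarrow> oper" where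
  "total_J hbar k = orbital hbar k + op_scale (hbar / 2) (sigma1 k + sigma2 k)"

definition J_squared :: "real \<Rightarrow> oper" where
  "J_squared hbar = op_inner (total_J hbar) (total_J hbar)"

definition K_op :: oper where
  "K_op = op_inner sigma1 sigma2"

definition Y_op :: "real \<Rightarrow> oper" where
  "Y_op hbar = op_scale (1 / 2) (op_inner (\<lambda>k. sigma1 k + sigma2 k) (momentum hbar))"

definition hamiltonian :: "real \<Rightarrow> (real \<Rightarrow> real) \<Rightarrow> real \<Rightarrow> oper" where
  "hamiltonian hbar V0 d9 =
     op_scale (- (hbar\<^sup>2 / 2)) laplacian
     + mult_op (\<lambda>x. V0 (norm x))
     + (mult_op (\<lambda>x. d9 - V0 (norm x)) \<circ> K_op)
     + op_scale (1 / 2) (op_inner sigma1 (momentum hbar) \<circ> op_inner sigma2 (momentum hbar))"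

end

theory Submission
  imports Defs
begin

text \<open>Let \<open>S = (\<sigma>\<^sub>1 + \<sigma>\<^sub>2) / 2\<close>, so that \<open>Y = (S, p)\<close>. The Pauli relations give \<open>S K = K S = S\<close>, hence
  \<open>Y K = K Y = Y\<close>, and \<open>(K - 1) (K + 3) = 0\<close>. As \<open>(\<sigma>\<^sub>1, p)\<^sup>2 = (\<sigma>\<^sub>2, p)\<^sup>2 = p\<^sup>2\<close>, we get
  \<open>Y\<^sup>2 = (p\<^sup>2 + (\<sigma>\<^sub>1, p) (\<sigma>\<^sub>2, p)) / 2\<close>, so that \<open>H = Y\<^sup>2 + d\<^sub>9 + (d\<^sub>9 - V\<^sub>0) (K - 1)\<close>. The relations between
  \<open>H\<close>, \<open>K\<close> and \<open>Y\<close> follow because \<open>K - 1\<close> annihilates \<open>Y\<close> on both sides. The operators \<open>x\<close>, \<open>p\<close>, \<open>\<sigma>\<^sub>1\<close>,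
  \<open>\<sigma>\<^sub>2\<close> are vectors under \<open>J\<close>, so their scalar products commute with \<open>J\<close>.

  These computations take place in an abstract algebra. They apply to differential operators because
  linear endomorphisms of the space of smooth waves form such an algebra; the only analytic input is
  the product rule, the symmetry of second derivatives and the smoothness of \<open>V\<^sub>0(|x|)\<close>.\<close>

section \<open>Smooth functions\<close>

lemma frechet_derivative_cong_open:
  assumes "open S" "x \<in> S" "\<And>y. y \<in> S \<Longrightarrow> f y = g y"
  shows "frechet_derivative f (at x) = frechet_derivative g (at x)"
proof -
  have "(f has_derivative D) (at x) \<longleftrightarrow> (g has_derivative D) (at x)" for D
    using assms by (metis has_derivative_transform_within_open)
  then show ?thesis
    unfolding frechet_derivative_def by simp
qed

lemma times_differentiable_on_cong:
  assumes "open S" "\<And>x. x \<in> S \<Longrightarrow> f x = g x" "times_differentiable_on n S f"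
  shows "times_differentiable_on n S g"
  using assms(2,3)
proof (induction n arbitrary: f g)
  case 0
  then show ?case by (metis continuous_on_eq times_differentiable_on.simps(1))
next
  case (Suc n)
  have "g differentiable (at x)" if "x \<in> S" for x
    using Suc.prems that assms(1) unfolding differentiable_def times_differentiable_on.simps
    by (metis has_derivative_transform_within_open)
  moreover have "times_differentiable_on n S (\<lambda>x. frechet_derivative g (at x) v)" for v
  proof (rule Suc.IH)
    show "times_differentiable_on n S (\<lambda>x. frechet_derivative f (at x) v)"
      using Suc.prems by simp
    show "frechet_derivative f (at x) v = frechet_derivative g (at x) v" if "x \<in> S" for x
      by (simp add: frechet_derivative_cong_open[OF assms(1) that Suc.prems(1)])
  qed
  ultimately show ?case by simp
qed

text \<open>Derivatives are unique, so on an open set any explicit family \<open>D\<close> may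
  replace \<open>frechet_derivative\<close> in the recursion. The closure rules below are inductions
  on the order through this rule.\<close>

lemma times_differentiable_onI:
  assumes "open S"
    and "\<And>x. x \<in> S \<Longrightarrow> (f has_derivative D x) (at x)"
    and "\<And>v. times_differentiable_on n S (\<lambda>x. D x v)"
  shows "times_differentiable_on (Suc n) S f"
proof -
  have "D x = frechet_derivative f (at x)" if "x \<in> S" for x
    using frechet_derivative_at[OF assms(2)[OF that]] .
  then show ?thesis
    using assms times_differentiable_on_cong[OF assms(1) _ assms(3)]
    by (auto simp: differentiable_def)
qed

lemma times_differentiable_on_imp_has_derivative:
  assumes "times_differentiable_on (Suc n) S f" "x \<in> S"
  shows "(f has_derivative frechet_derivative f (at x)) (at x)"
  using assms by (simp flip: frechet_derivative_works)

lemma times_differentiable_on_Suc_imp: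
  "times_differentiable_on (Suc n) S f \<Longrightarrow> times_differentiable_on n S f"
proof (induction n arbitrary: f)
  case 0
  then show ?case
    by (simp add: differentiable_imp_continuous_within continuous_at_imp_continuous_on)
qed auto

lemma times_differentiable_on_const:
  "open S \<Longrightarrow> times_differentiable_on n S (\<lambda>x. c)"
proof (induction n arbitrary: c)
  case (Suc n)
  then show ?case
    by (intro times_differentiable_onI[where D = "\<lambda>x v. 0"]) auto
qed simp

lemma times_differentiable_on_bounded_linear:
  assumes "open S" "bounded_linear h" "times_differentiable_on n S f"
  shows "times_differentiable_on n S (\<lambda>x. h (f x))"
  using assms(3)
proof (induction n arbitrary: f)
  case 0
  then show ?case
    using assms(2) by (auto intro: bounded_linear.continuous_on)
next
  case (Suc n)
  show ?case
  proof (rule times_differentiable_onI[OF assms(1)])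
    show "((\<lambda>x. h (f x)) has_derivative (\<lambda>v. h (frechet_derivative f (at x) v))) (at x)"
      if "x \<in> S" for x
      by (rule bounded_linear.has_derivative[OF assms(2)
            times_differentiable_on_imp_has_derivative[OF Suc.prems that]])
    show "times_differentiable_on n S (\<lambda>x. h (frechet_derivative f (at x) v))" for v
      using Suc by simp
  qed
qed

lemma times_differentiable_on_add:
  assumes "open S" "times_differentiable_on n S f" "times_differentiable_on n S g"
  shows "times_differentiable_on n S (\<lambda>x. f x + g x)"
  using assms(2,3)
proof (induction n arbitrary: f g)
  case 0
  then show ?case by (auto intro: continuous_on_add)
next
  case (Suc n)
  show ?case
  proof (rule times_differentiable_onI[OF assms(1)])
    show "((\<lambda>x. f x + g x) has_derivative
        (\<lambda>v. frechet_derivative f (at x) v + frechet_derivative g (at x) v)) (at x)"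
      if "x \<in> S" for x
      by (rule has_derivative_add[OF times_differentiable_on_imp_has_derivative[OF Suc.prems(1) that]
            times_differentiable_on_imp_has_derivative[OF Suc.prems(2) that]])
    show "times_differentiable_on n S
        (\<lambda>x. frechet_derivative f (at x) v + frechet_derivative g (at x) v)" for v
      using Suc by simp
  qed
qed

text \<open>The product rule pairs the derivative of one factor with the other factor itself. Hence
  the induction runs over both functions at once, and the undifferentiated factor is first lowered
  from order \<open>Suc n\<close> to order \<open>n\<close>.\<close>

lemma times_differentiable_on_bounded_bilinear:
  assumes "open S" "bounded_bilinear b"
    and "times_differentiable_on n S f" "times_differentiable_on n S g"
  shows "times_differentiable_on n S (\<lambda>x. b (f x) (g x))"
  using assms(3,4)
proof (induction n arbitrary: f g)
  case 0
  then show ?case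
    using bounded_bilinear.continuous_on[OF assms(2)] by simp
next
  case (Suc n)
  show ?case
  proof (rule times_differentiable_onI[OF assms(1)])
    show "((\<lambda>x. b (f x) (g x)) has_derivative
        (\<lambda>v. b (f x) (frechet_derivative g (at x) v) + b (frechet_derivative f (at x) v) (g x)))
        (at x)"
      if "x \<in> S" for x
      by (rule bounded_bilinear.FDERIV[OF assms(2)
            times_differentiable_on_imp_has_derivative[OF Suc.prems(1) that]
            times_differentiable_on_imp_has_derivative[OF Suc.prems(2) that]])
    show "times_differentiable_on n S
        (\<lambda>x. b (f x) (frechet_derivative g (at x) v) + b (frechet_derivative f (at x) v) (g x))" for v
      using Suc.prems
      by (intro times_differentiable_on_add[OF assms(1)]
          Suc.IH[OF times_differentiable_on_Suc_imp[OF Suc.prems(1)]]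
          Suc.IH[OF _ times_differentiable_on_Suc_imp[OF Suc.prems(2)]]) simp_all
  qed
qed

lemma smooth_on_cong:
  "open S \<Longrightarrow> (\<And>x. x \<in> S \<Longrightarrow> f x = g x) \<Longrightarrow> smooth_on S f \<Longrightarrow> smooth_on S g"
  unfolding smooth_on_def using times_differentiable_on_cong by blast

lemma smooth_on_const: "open S \<Longrightarrow> smooth_on S (\<lambda>x. c)"
  by (simp add: smooth_on_def times_differentiable_on_const)

lemma smooth_on_bounded_linear:
  "open S \<Longrightarrow> bounded_linear h \<Longrightarrow> smooth_on S f \<Longrightarrow> smooth_on S (\<lambda>x. h (f x))"
  by (simp add: smooth_on_def times_differentiable_on_bounded_linear)

lemma smooth_on_add:
  "open S \<Longrightarrow> smooth_on S f \<Longrightarrow> smooth_on S g \<Longrightarrow> smooth_on S (\<lambda>x. f x + g x)"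
  by (simp add: smooth_on_def times_differentiable_on_add)

lemma smooth_on_scaleR: "open S \<Longrightarrow> smooth_on S f \<Longrightarrow> smooth_on S (\<lambda>x. c *\<^sub>R f x)"
  by (rule smooth_on_bounded_linear[OF _ bounded_linear_scaleR_right])

lemma smooth_on_minus: "open S \<Longrightarrow> smooth_on S f \<Longrightarrow> smooth_on S (\<lambda>x. - f x)"
  by (rule smooth_on_bounded_linear[OF _ bounded_linear_minus[OF bounded_linear_ident]])

lemma smooth_on_diff:
  "open S \<Longrightarrow> smooth_on S f \<Longrightarrow> smooth_on S g \<Longrightarrow> smooth_on S (\<lambda>x. f x - g x)"
  using smooth_on_add[OF _ _ smooth_on_minus] by fastforce

lemma smooth_on_bounded_bilinear:
  "open S \<Longrightarrow> bounded_bilinear b \<Longrightarrow> smooth_on S f \<Longrightarrow> smooth_on S g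
    \<Longrightarrow> smooth_on S (\<lambda>x. b (f x) (g x))"
  by (simp add: smooth_on_def times_differentiable_on_bounded_bilinear)

lemma smooth_on_frechet_derivative:
  "smooth_on S f \<Longrightarrow> smooth_on S (\<lambda>x. frechet_derivative f (at x) v)"
  unfolding smooth_on_def using times_differentiable_on.simps(2) by blast

lemma smooth_on_imp_has_derivative:
  "smooth_on S f \<Longrightarrow> x \<in> S \<Longrightarrow> (f has_derivative frechet_derivative f (at x)) (at x)"
  unfolding smooth_on_def using times_differentiable_on_imp_has_derivative by blast

lemma smooth_on_imp_continuous_on: "smooth_on S f \<Longrightarrow> continuous_on S f"
  unfolding smooth_on_def using times_differentiable_on.simps(1) by blast

lemma smooth_on_ident: "open S \<Longrightarrow> smooth_on S (\<lambda>x. x)"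
  unfolding smooth_on_def
proof
  show "times_differentiable_on n S (\<lambda>x. x)" if "open S" for n
    using that
    by (cases n) (auto intro!: times_differentiable_onI[where D = "\<lambda>x v. v"]
        times_differentiable_on_const simp del: times_differentiable_on.simps(2))
qed

section \<open>Smoothness of radial functions away from the origin\<close>

lemma smooth_on_inverse: "smooth_on {0<..} (inverse :: real \<Rightarrow> real)"
proof -
  have "times_differentiable_on n {0<..} (inverse :: real \<Rightarrow> real)" for n
  proof (induction n)
    case 0
    show ?case by (auto intro!: continuous_intros)
  next
    case (Suc n)
    show ?case
    proof (rule times_differentiable_onI)
      show "(inverse has_derivative (\<lambda>v. - (inverse x * v * inverse x))) (at x)"
        if "x \<in> {0<..}" for x :: real
        using that by (auto intro!: derivative_eq_intros)
      have "times_differentiable_on n {0<..} (\<lambda>x::real. (- v) * (inverse x * inverse x))" for v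
        by (rule times_differentiable_on_bounded_linear[OF _ bounded_linear_mult_right
              times_differentiable_on_bounded_bilinear[OF _ bounded_bilinear_mult Suc Suc]]) auto
      then show "times_differentiable_on n {0<..} (\<lambda>x::real. - (inverse x * v * inverse x))" for v
        by (simp add: mult_ac)
    qed auto
  qed
  then show ?thesis by (simp add: smooth_on_def)
qed

text \<open>For \<open>v\<close> a coordinate vector the derivative is a coordinate of
  \<open>x\<close> times the radial function \<open>g'(r) / r\<close>. This is the form in which
  rotation invariance of the potential enters later.\<close>

lemma has_derivative_compose_norm:
  fixes g :: "real \<Rightarrow> 'b::real_normed_vector" and x :: "'a::real_inner"
  assumes "smooth_on {0<..} g" "x \<noteq> 0"
  shows "((\<lambda>x. g (norm x)) has_derivative
    (\<lambda>v. (inverse (norm x) * inner v x) *\<^sub>R frechet_derivative g (at (norm x)) 1)) (at x)"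
proof -
  have g: "(g has_derivative frechet_derivative g (at (norm x))) (at (norm x))"
    using assms by (intro smooth_on_imp_has_derivative) auto
  have lin: "frechet_derivative g (at (norm x)) h = h *\<^sub>R frechet_derivative g (at (norm x)) 1" for h
    using linear_scale[OF has_derivative_linear[OF g], of h 1] by simp
  have "(\<lambda>v. frechet_derivative g (at (norm x)) (inner v (sgn x))) =
      (\<lambda>v. (inverse (norm x) * inner v x) *\<^sub>R frechet_derivative g (at (norm x)) 1)"
    by (rule ext, subst lin) (simp add: sgn_div_norm)
  with has_derivative_compose[OF has_derivative_norm[OF assms(2)] g]
  show ?thesis by simp
qed

text \<open>The derivative of \<open>g(|x|)\<close> contains \<open>g'\<close> in place of
  \<open>g\<close>, so the induction on the order is carried out for all smooth \<open>g\<close>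
  simultaneously.\<close>

lemma smooth_on_compose_norm:
  fixes g :: "real \<Rightarrow> 'b::real_normed_vector"
  assumes "smooth_on {0<..} g"
  shows "smooth_on (- {0}) (\<lambda>x::'a::real_inner. g (norm x))"
proof -
  \<comment> \<open>The factor \<open>1/|x|\<close> occurs in the derivative for every
    \<open>g\<close>, so it is treated first. Its own derivative is \<open>-|x|^-3\<close> times the
    inner product of \<open>v\<close> and \<open>x\<close>, built from factors already known to
    order \<open>n\<close>.\<close>
  have inv: "times_differentiable_on n (- {0}) (\<lambda>x::'a. inverse (norm x))" for n
  proof (induction n)
    case 0
    show ?case by (auto intro!: continuous_intros)
  next
    case (Suc n)
    have 2: "times_differentiable_on n (- {0}) (\<lambda>x::'a. inverse (norm x) * inverse (norm x))"
      by (rule times_differentiable_on_bounded_bilinear[OF _ bounded_bilinear_mult Suc Suc]) auto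
    have 3: "times_differentiable_on n (- {0}) (\<lambda>x::'a. inverse (norm x) * (inverse (norm x) * inverse (norm x)))"
      by (rule times_differentiable_on_bounded_bilinear[OF _ bounded_bilinear_mult Suc 2]) auto
    have v: "times_differentiable_on n (- {0}) (\<lambda>x::'a. inner v x)" for v
      by (rule times_differentiable_on_bounded_linear[OF _ bounded_linear_inner_right])
         (use smooth_on_ident[of "- {0::'a}"] in \<open>auto simp: smooth_on_def\<close>)
    have 4: "times_differentiable_on n (- {0})
         (\<lambda>x::'a. (-1) *\<^sub>R ((inverse (norm x) * (inverse (norm x) * inverse (norm x))) * inner v x))" for v
      by (rule times_differentiable_on_bounded_linear[OF _ bounded_linear_scaleR_right
            times_differentiable_on_bounded_bilinear[OF _ bounded_bilinear_mult 3 v]]) auto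
    show ?case
    proof (rule times_differentiable_onI[OF _ _ 4])
      show "((\<lambda>x::'a. inverse (norm x)) has_derivative
          (\<lambda>v. (-1) *\<^sub>R ((inverse (norm x) * (inverse (norm x) * inverse (norm x))) * inner v x))) (at x)"
        if "x \<in> - {0}" for x
        by (rule has_derivative_eq_rhs[OF Deriv.has_derivative_inverse[OF _ has_derivative_norm]])
           (use that in \<open>auto simp: sgn_div_norm field_simps\<close>)
    qed auto
  qed
  have "times_differentiable_on n (- {0}) (\<lambda>x::'a. g (norm x))" for n
    using assms
  proof (induction n arbitrary: g)
    case 0
    then have "continuous_on {0<..} g" by (rule smooth_on_imp_continuous_on)
    then show ?case
      by (auto intro!: continuous_intros intro: continuous_on_compose2)
  next
    case (Suc n)
    have v: "times_differentiable_on n (- {0}) (\<lambda>x::'a. inner v x)" for v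
      by (rule times_differentiable_on_bounded_linear[OF _ bounded_linear_inner_right])
         (use smooth_on_ident[of "- {0::'a}"] in \<open>auto simp: smooth_on_def\<close>)
    have "times_differentiable_on n (- {0}) (\<lambda>x::'a. (inverse (norm x) * inner v x) *\<^sub>R
           frechet_derivative g (at (norm x)) 1)" for v
      by (rule times_differentiable_on_bounded_bilinear[OF _ bounded_bilinear_scaleR
            times_differentiable_on_bounded_bilinear[OF _ bounded_bilinear_mult inv v]
            Suc.IH[OF smooth_on_frechet_derivative[OF Suc.prems]]]) auto
    then show ?case
      using has_derivative_compose_norm[OF Suc.prems]
      by (intro times_differentiable_onI[where D = "\<lambda>x v. (inverse (norm x) * inner v x) *\<^sub>R
           frechet_derivative g (at (norm x)) 1"]) auto
  qed
  then show ?thesis by (simp add: smooth_on_def)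
qed

section \<open>Symmetry of second derivatives\<close>

lemma second_difference_eq_second_derivative:
  fixes f :: "'a::real_normed_vector \<Rightarrow> real"
  assumes f: "smooth_on S f" and h: "h > 0"
    and S: "\<And>s t. \<lbrakk>0 \<le> s; s \<le> h; 0 \<le> t; t \<le> h\<rbrakk> \<Longrightarrow> x + s *\<^sub>R u + t *\<^sub>R v \<in> S"
  obtains s t where "0 < s" "s < h" "0 < t" "t < h"
    "f (x + h *\<^sub>R u + h *\<^sub>R v) - f (x + h *\<^sub>R u) - f (x + h *\<^sub>R v) + f x =
     h * h * frechet_derivative (\<lambda>y. frechet_derivative f (at y) u) (at (x + s *\<^sub>R u + t *\<^sub>R v)) v"
proof -
  define g where "g y = frechet_derivative f (at y) u" for y
  have g: "smooth_on S g"
    unfolding g_def by (rule smooth_on_frechet_derivative[OF f])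
  have dir: "((\<lambda>s. k (y + s *\<^sub>R w)) has_real_derivative frechet_derivative k (at (y + s *\<^sub>R w)) w) (at s)"
    if "smooth_on S k" "y + s *\<^sub>R w \<in> S" for k :: "'a \<Rightarrow> real" and y w s
  proof -
    have k: "(k has_derivative frechet_derivative k (at (y + s *\<^sub>R w))) (at (y + s *\<^sub>R w))"
      using that by (rule smooth_on_imp_has_derivative)
    have "((\<lambda>s. k (y + s *\<^sub>R w)) has_derivative
        (\<lambda>r. frechet_derivative k (at (y + s *\<^sub>R w)) (r *\<^sub>R w))) (at s)"
      by (rule has_derivative_compose[where f = "\<lambda>s. y + s *\<^sub>R w", OF _ k]) (auto intro!: derivative_eq_intros)
    moreover have "frechet_derivative k (at (y + s *\<^sub>R w)) (r *\<^sub>R w) =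
        frechet_derivative k (at (y + s *\<^sub>R w)) w * r" for r
      using linear_scale[OF has_derivative_linear[OF k]] by (simp add: mult.commute)
    ultimately show ?thesis
      by (simp add: has_field_derivative_def)
  qed
  \<comment> \<open>The second difference over the parallelogram with sides \<open>h u\<close> and
    \<open>h v\<close> is the change, from \<open>s = 0\<close> to \<open>s = h\<close>, of the
    increment of \<open>f\<close> by \<open>h v\<close> at \<open>x + s u\<close>. The mean value
    theorem in \<open>s\<close> turns it into an increment of \<open>g\<close>; a second
    application, in \<open>t\<close> along \<open>v\<close>, produces the second derivative.\<close>
  have "\<exists>s. 0 < s \<and> s < h \<and>
      (f (x + h *\<^sub>R v + h *\<^sub>R u) - f (x + h *\<^sub>R u)) - (f (x + h *\<^sub>R v + 0 *\<^sub>R u) - f (x + 0 *\<^sub>R u)) =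
      (h - 0) * (g (x + h *\<^sub>R v + s *\<^sub>R u) - g (x + s *\<^sub>R u))"
  proof (rule MVT2[OF h])
    fix s assume "0 \<le> s" "s \<le> h"
    then have "x + h *\<^sub>R v + s *\<^sub>R u \<in> S" "x + s *\<^sub>R u \<in> S"
      using S[of s h] S[of s 0] h by (simp_all add: algebra_simps)
    then show "((\<lambda>s. f (x + h *\<^sub>R v + s *\<^sub>R u) - f (x + s *\<^sub>R u)) has_real_derivative
        g (x + h *\<^sub>R v + s *\<^sub>R u) - g (x + s *\<^sub>R u)) (at s)"
      unfolding g_def by (intro DERIV_diff dir f)
  qed
  then obtain s where s: "0 < s" "s < h" and 1:
      "(f (x + h *\<^sub>R v + h *\<^sub>R u) - f (x + h *\<^sub>R u)) - (f (x + h *\<^sub>R v + 0 *\<^sub>R u) - f (x + 0 *\<^sub>R u)) =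
       (h - 0) * (g (x + h *\<^sub>R v + s *\<^sub>R u) - g (x + s *\<^sub>R u))"
    by blast
  have "\<exists>t. 0 < t \<and> t < h \<and> g (x + s *\<^sub>R u + h *\<^sub>R v) - g (x + s *\<^sub>R u + 0 *\<^sub>R v) =
      (h - 0) * frechet_derivative g (at (x + s *\<^sub>R u + t *\<^sub>R v)) v"
    using s S by (intro MVT2[OF h] dir g) auto
  then obtain t where t: "0 < t" "t < h" and 2: "g (x + s *\<^sub>R u + h *\<^sub>R v) - g (x + s *\<^sub>R u + 0 *\<^sub>R v) =
      (h - 0) * frechet_derivative g (at (x + s *\<^sub>R u + t *\<^sub>R v)) v"
    by blast
  have swap: "x + h *\<^sub>R v + s *\<^sub>R u = x + s *\<^sub>R u + h *\<^sub>R v" for s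
    by (simp add: algebra_simps)
  show thesis
    using that[OF s t] 1 2 by (simp add: swap g_def[symmetric] algebra_simps)
qed

text \<open>The second difference is symmetric in \<open>u\<close> and \<open>v\<close>. So the two
  mixed derivatives take a common value at two points of a small parallelogram at \<open>x\<close>,
  which continuity forbids if they differ at \<open>x\<close> itself.\<close>

lemma symmetric_second_derivative_real:
  fixes f :: "'a::real_normed_vector \<Rightarrow> real"
  assumes f: "smooth_on S f" and S: "open S" "x \<in> S"
  shows "frechet_derivative (\<lambda>y. frechet_derivative f (at y) u) (at x) v =
         frechet_derivative (\<lambda>y. frechet_derivative f (at y) v) (at x) u"
proof (rule ccontr)
  define D where "D u v y = frechet_derivative (\<lambda>y. frechet_derivative f (at y) u) (at y) v" for u v y
  assume "\<not> ?thesis"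
  \<comment> \<open>Half the gap: two numbers that are closer than this to \<open>D u v x\<close>
    and \<open>D v u x\<close> respectively cannot coincide.\<close>
  then have e: "\<bar>D u v x - D v u x\<bar> / 2 > 0" (is "?e > 0")
    by (simp add: D_def)
  have "isCont (D a b) x" for a b
    unfolding D_def using S
    by (intro continuous_on_interior[of S] smooth_on_imp_continuous_on smooth_on_frechet_derivative f)
       (simp add: interior_open)
  then have "\<forall>\<^sub>F y in nhds x. dist (D a b y) (D a b x) < ?e" for a b
    using e unfolding isCont_def tendsto_at_iff_tendsto_nhds by (rule tendstoD)
  from eventually_conj[OF this[of u v] eventually_conj[OF this[of v u] eventually_nhds_in_open[OF S]]]
  obtain d where d: "d > 0" and near: "\<And>y. dist y x < d \<Longrightarrow>
      dist (D u v y) (D u v x) < ?e \<and> dist (D v u y) (D v u x) < ?e \<and> y \<in> S"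
    unfolding eventually_nhds_metric by blast
  \<comment> \<open>This makes \<open>h (|u| + |v|)\<close> at most \<open>d / 2\<close>, so both
    parallelograms stay in the ball of radius \<open>d\<close>. The summand 1 keeps the denominator
    positive when \<open>u\<close> and \<open>v\<close> vanish.\<close>
  define h where "h = d / (2 * (norm u + norm v + 1))"
  have pos: "norm u + norm v + 1 > 0" by (smt (verit) norm_ge_zero)
  have h: "h > 0" using d pos by (simp add: h_def)
  have close: "dist (x + s *\<^sub>R a + t *\<^sub>R b) x < d"
    if "0 \<le> s" "s \<le> h" "0 \<le> t" "t \<le> h" "norm a + norm b = norm u + norm v" for s t a b
  proof -
    have "norm (s *\<^sub>R a + t *\<^sub>R b) \<le> s * norm a + t * norm b"
      using that norm_triangle_ineq[of "s *\<^sub>R a" "t *\<^sub>R b"] by simp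
    also have "\<dots> \<le> h * norm a + h * norm b"
      using that by (intro add_mono mult_right_mono) auto
    also have "\<dots> = h * (norm u + norm v)"
      using that(5) by (simp flip: distrib_left)
    also have "\<dots> \<le> h * (norm u + norm v + 1)"
      using h by simp
    also have "\<dots> = d / 2"
      using pos unfolding h_def by (simp add: field_simps)
    also have "\<dots> < d"
      using d by simp
    finally show ?thesis by (simp add: dist_norm add.assoc)
  qed
  obtain s t where "0 < s" "s < h" "0 < t" "t < h" and 1:
    "f (x + h *\<^sub>R u + h *\<^sub>R v) - f (x + h *\<^sub>R u) - f (x + h *\<^sub>R v) + f x = h * h * D u v (x + s *\<^sub>R u + t *\<^sub>R v)"
    unfolding D_def
    by (rule second_difference_eq_second_derivative[OF f h, where x = x and u = u and v = v])
       (use near close in auto)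
  then have uv: "dist (D u v (x + s *\<^sub>R u + t *\<^sub>R v)) (D u v x) < ?e"
    using near[OF close[of s t u v]] by simp
  obtain s' t' where "0 < s'" "s' < h" "0 < t'" "t' < h" and 2:
    "f (x + h *\<^sub>R v + h *\<^sub>R u) - f (x + h *\<^sub>R v) - f (x + h *\<^sub>R u) + f x = h * h * D v u (x + s' *\<^sub>R v + t' *\<^sub>R u)"
    unfolding D_def
    by (rule second_difference_eq_second_derivative[OF f h, where x = x and u = v and v = u])
       (use near close in auto)
  then have vu: "dist (D v u (x + s' *\<^sub>R v + t' *\<^sub>R u)) (D v u x) < ?e"
    using near[OF close[of s' t' v u]] by simp
  have "x + h *\<^sub>R u + h *\<^sub>R v = x + h *\<^sub>R v + h *\<^sub>R u"
    by (simp add: algebra_simps)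
  then have "h * h * D u v (x + s *\<^sub>R u + t *\<^sub>R v) = h * h * D v u (x + s' *\<^sub>R v + t' *\<^sub>R u)"
    using 1 2 by (simp add: algebra_simps)
  then have "D u v (x + s *\<^sub>R u + t *\<^sub>R v) = D v u (x + s' *\<^sub>R v + t' *\<^sub>R u)"
    using h by simp
  with uv vu show False
    by (simp add: dist_real_def) argo
qed

lemma frechet_derivative_bounded_linear:
  assumes "bounded_linear h" "f differentiable (at x)"
  shows "frechet_derivative (\<lambda>x. h (f x)) (at x) = (\<lambda>v. h (frechet_derivative f (at x) v))"
  using bounded_linear.has_derivative[OF assms(1) assms(2)[unfolded frechet_derivative_works]]
  by (metis frechet_derivative_at)

text \<open>The mean value theorem needs real values. Taking the inner product with a basis vector
  is bounded linear, passes through both derivatives and so reduces the claim to the real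
  case.\<close>

lemma symmetric_second_derivative:
  fixes f :: "'a::real_normed_vector \<Rightarrow> 'b::euclidean_space"
  assumes f: "smooth_on S f" and S: "open S" "x \<in> S"
  shows "frechet_derivative (\<lambda>y. frechet_derivative f (at y) u) (at x) v =
         frechet_derivative (\<lambda>y. frechet_derivative f (at y) v) (at x) u"
proof (rule euclidean_eqI)
  fix b :: 'b assume "b \<in> Basis"
  have diff: "k differentiable (at y)" if "smooth_on S k" "y \<in> S" for k :: "'a \<Rightarrow> 'b" and y
    using smooth_on_imp_has_derivative[OF that] by (auto simp: differentiable_def)
  have "frechet_derivative (\<lambda>y. frechet_derivative (\<lambda>y. inner (f y) b) (at y) u) (at x) v =
        inner (frechet_derivative (\<lambda>y. frechet_derivative f (at y) u) (at x) v) b" for u v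
  proof -
    have "frechet_derivative (\<lambda>y. frechet_derivative (\<lambda>y. inner (f y) b) (at y) u) (at x) =
          frechet_derivative (\<lambda>y. inner (frechet_derivative f (at y) u) b) (at x)"
      using diff[OF f]
      by (intro frechet_derivative_cong_open[OF S])
         (simp add: frechet_derivative_bounded_linear[OF bounded_linear_inner_left])
    then show ?thesis
      using diff[OF smooth_on_frechet_derivative[OF f] S(2)]
      by (simp add: frechet_derivative_bounded_linear[OF bounded_linear_inner_left])
  qed
  then show "inner (frechet_derivative (\<lambda>y. frechet_derivative f (at y) u) (at x) v) b =
      inner (frechet_derivative (\<lambda>y. frechet_derivative f (at y) v) (at x) u) b"
    using symmetric_second_derivative_real[OF smooth_on_bounded_linear[OF S(1) bounded_linear_inner_left f] S]
    by metis
qed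

section \<open>Spin and angular momentum algebra\<close>

text \<open>Turns a relation for a product of two elements into a rewrite rule that also applies
  inside a product nested to the right.\<close>

lemma mult_assoc_subst:
  fixes x y :: "'r::semigroup_mult"
  shows "x * y = w \<Longrightarrow> x * (y * z) = w * z"
  by (simp flip: mult.assoc)

text \<open>The variant for mutually commuting families such as the \<open>x k\<close> or the
  \<open>p k\<close>: both sides have the same shape, so the simplifier treats it as ordered
  rewriting and does not loop.\<close>

lemma commute_left_subst:
  fixes x y :: "'r::semigroup_mult"
  shows "x * y = y * x \<Longrightarrow> x * (y * z) = y * (x * z)"
  by (simp flip: mult.assoc)

section \<open>Cyclic indices, scalar and vector products, vector operators\<close>

definition next3 :: "3 \<Rightarrow> 3" where "next3 k = k + 1"
definition prev3 :: "3 \<Rightarrow> 3" where "prev3 k = k + 2"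

lemma next3_prev3 [simp]:
  "next3 (next3 k) = prev3 k" "next3 (prev3 k) = k" "prev3 (next3 k) = k" "prev3 (prev3 k) = next3 k"
  by (simp_all add: next3_def prev3_def add.assoc)

lemma next3_neq [simp]:
  "next3 k \<noteq> k" "k \<noteq> next3 k" "prev3 k \<noteq> k" "k \<noteq> prev3 k" "next3 k \<noteq> prev3 k" "prev3 k \<noteq> next3 k"
  by (simp_all add: next3_def prev3_def)

text \<open>The commutation relations are stated relative to an index \<open>k\<close>. Starting the
  sum at that same index lets them rewrite every summand without a case distinction.\<close>

lemma sum_three_cyclic: "sum f (UNIV :: 3 set) = f k + f (next3 k) + f (prev3 k)"
proof -
  have "card {k, next3 k, prev3 k} = CARD(3)"
    by simp
  then have "{k, next3 k, prev3 k} = UNIV"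
    by (intro card_subset_eq) auto
  then have "sum f UNIV = sum f {k, next3 k, prev3 k}"
    by simp
  then show ?thesis
    by (simp add: add.assoc)
qed

definition dot :: "(3 \<Rightarrow> 'r::real_algebra_1) \<Rightarrow> (3 \<Rightarrow> 'r) \<Rightarrow> 'r" where
  "dot A B = (\<Sum>k\<in>UNIV. A k * B k)"

definition cross :: "(3 \<Rightarrow> 'r::real_algebra_1) \<Rightarrow> (3 \<Rightarrow> 'r) \<Rightarrow> 3 \<Rightarrow> 'r" where
  "cross A B k = A (next3 k) * B (prev3 k) - A (prev3 k) * B (next3 k)"

text \<open>The indices live in the three-element type, where addition is modulo 3. So this says
  \<open>[J\<^sub>j, A\<^sub>k] = \<Sum>\<^sub>l \<epsilon>\<^sub>j\<^sub>k\<^sub>l h A\<^sub>l\<close> with \<open>h\<close> in the role of \<open>\<i>\<hbar>\<close>.\<close>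

definition vector_under :: "'r::real_algebra_1 \<Rightarrow> (3 \<Rightarrow> 'r) \<Rightarrow> (3 \<Rightarrow> 'r) \<Rightarrow> bool" where
  "vector_under h J A \<longleftrightarrow> (\<forall>k. h * A k = A k * h \<and> J k * A k = A k * J k \<and>
     J k * A (next3 k) = A (next3 k) * J k + h * A (prev3 k) \<and>
     J k * A (prev3 k) = A (prev3 k) * J k - h * A (next3 k))"

lemma vector_underD:
  assumes "vector_under h J A"
  shows "A k * h = h * A k" "J k * A k = A k * J k"
    "J k * A (next3 k) = A (next3 k) * J k + h * A (prev3 k)"
    "J k * A (prev3 k) = A (prev3 k) * J k - h * A (next3 k)"
  using assms unfolding vector_under_def by auto

text \<open>The corrections from the summands at \<open>next3 k\<close> and \<open>prev3 k\<close>
  are \<open>h\<close> times the same two mixed products with opposite signs, because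
  \<open>h\<close> commutes with the components of \<open>A\<close>. No commutation between
  \<open>A\<close> and \<open>B\<close> enters.\<close>

lemma commutes_dot:
  assumes A: "vector_under h J A" and B: "vector_under h J B"
  shows "J k * dot A B = dot A B * J k"
  unfolding dot_def sum_three_cyclic[of _ k]
  by (simp add: algebra_simps vector_underD[OF A] vector_underD[OF B]
      vector_underD[OF A, THEN mult_assoc_subst] vector_underD[OF B, THEN mult_assoc_subst])

lemma vector_under_cross:
  assumes A: "vector_under h J A" and B: "vector_under h J B"
  shows "vector_under h J (cross A B)"
  unfolding vector_under_def cross_def
  by (simp add: algebra_simps vector_underD[OF A] vector_underD[OF B]
      vector_underD[OF A, THEN mult_assoc_subst] vector_underD[OF B, THEN mult_assoc_subst])

lemma vector_under_add:
  assumes "vector_under h J A" "vector_under h J B"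
  shows "vector_under h J (\<lambda>k. A k + B k)"
  unfolding vector_under_def by (simp add: vector_underD[OF assms(1)] vector_underD[OF assms(2)] algebra_simps)

lemma vector_under_scaleR:
  assumes "vector_under h J A"
  shows "vector_under h J (\<lambda>k. c *\<^sub>R A k)"
  unfolding vector_under_def by (simp add: vector_underD[OF assms] algebra_simps)

text \<open>Serves to pass from orbital to total angular momentum: the spin part commutes with
  position and momentum.\<close>

lemma vector_under_add_commuting:
  assumes "vector_under h J A" "\<And>j k. M j * A k = A k * M j"
  shows "vector_under h (\<lambda>k. J k + M k) A"
  unfolding vector_under_def by (simp add: vector_underD[OF assms(1)] assms(2) algebra_simps)

lemma dot_self_commutes:
  assumes "\<And>k. J k * a = a * J k"
  shows "dot J J * a = a * dot J J"
  by (simp add: dot_def sum_three_cyclic[of _ 1] algebra_simps assms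
      assms[THEN mult_assoc_subst])

text \<open>\<open>f\<close> stands for multiplication by a radial function, so that \<open>[p\<^sub>k, f]\<close> is a multiple of \<open>x\<^sub>k\<close>.
  Rotation invariance of \<open>f\<close> is used only in this form.\<close>

locale two_spin_particle =
  fixes hbar :: real and I f g0 :: "'r::real_algebra_1" and x p s t :: "3 \<Rightarrow> 'r"
  assumes I_square: "I * I = - 1"
    and I_commutes: "x k * I = I * x k" "p k * I = I * p k" "s k * I = I * s k" "t k * I = I * t k"
    and x_x: "x j * x k = x k * x j"
    and p_p: "p j * p k = p k * p j"
    and p_x: "p j * x k = x k * p j - (if j = k then hbar *\<^sub>R I else 0)"
    and s_spin: "s k * s k = 1" "s k * s (next3 k) = I * s (prev3 k)" "s (next3 k) * s k = - (I * s (prev3 k))"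
    and t_spin: "t k * t k = 1" "t k * t (next3 k) = I * t (prev3 k)" "t (next3 k) * t k = - (I * t (prev3 k))"
    and t_s: "t j * s k = s k * t j"
    and spin_space: "s j * x k = x k * s j" "s j * p k = p k * s j"
      "t j * x k = x k * t j" "t j * p k = p k * t j"
    and f_commutes: "f * x k = x k * f" "f * s k = s k * f" "f * t k = t k * f"
    and p_f: "p k * f = f * p k + x k * g0"
    and g_commutes: "g0 * x k = x k * g0"
begin

section \<open>Pauli relations and their consequences for \<open>K\<close>, \<open>Y\<close> and
  \<open>H\<close>\<close>

lemma s_spin': "s k * s (prev3 k) = - (I * s (next3 k))" "s (prev3 k) * s k = I * s (next3 k)"
  "s (next3 k) * s (prev3 k) = I * s k" "s (prev3 k) * s (next3 k) = - (I * s k)"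
  using s_spin[of "next3 k"] s_spin[of "prev3 k"] by simp_all

lemma t_spin': "t k * t (prev3 k) = - (I * t (next3 k))" "t (prev3 k) * t k = I * t (next3 k)"
  "t (next3 k) * t (prev3 k) = I * t k" "t (prev3 k) * t (next3 k) = - (I * t k)"
  using t_spin[of "next3 k"] t_spin[of "prev3 k"] by simp_all

lemmas spin_rules = s_spin s_spin' t_spin t_spin' t_s I_commutes(3,4) I_square

lemmas spin_simps = spin_rules spin_rules[THEN mult_assoc_subst]

definition "L = cross x p"
definition "S k = (1/2) *\<^sub>R (s k + t k)"
definition "J k = L k + (hbar / 2) *\<^sub>R (s k + t k)"
definition "K = dot s t"
definition "Y = dot S p"
definition "H d = (1/2) *\<^sub>R dot p p + f + (of_real d - f) * K + (1/2) *\<^sub>R (dot s p * dot t p)"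

text \<open>The total spin in units of \<open>hbar\<close> generates the rotations of both spins,
  hence \<open>I\<close> and not \<open>hbar I\<close> as structure constant.\<close>

lemma vector_under_S: "vector_under I S s" "vector_under I S t" "vector_under I S S"
proof -
  show s: "vector_under I S s" and t: "vector_under I S t"
    unfolding vector_under_def S_def by (simp_all add: spin_simps algebra_simps flip: scaleR_2)
  show "vector_under I S S"
    using vector_under_scaleR[OF vector_under_add[OF s t], of "1/2"] unfolding S_def[symmetric] .
qed

text \<open>In physical terms, \<open>K\<close> is 1 on the triplet, while \<open>S\<close>
  preserves the triplet and vanishes on the singlet. Here one order is multiplied out, and the other
  follows because \<open>K\<close> is a scalar under \<open>S\<close>.\<close>

lemma S_K: "S k * K = S k" "K * S k = S k"
proof -
  have "S k * K = K * S k"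
    unfolding K_def by (rule commutes_dot[OF vector_under_S(1,2)])
  show "K * S k = S k"
    unfolding K_def dot_def S_def sum_three_cyclic[of _ k]
    by (simp add: spin_simps algebra_simps)
  then show "S k * K = S k"
    using \<open>S k * K = K * S k\<close> by simp
qed

text \<open>This is \<open>(K - 1) (K + 3) = 0\<close> multiplied out; 1 and -3 are the triplet and
  singlet values of \<open>K\<close>.\<close>

lemma K_square: "K * K = 3 *\<^sub>R 1 - 2 *\<^sub>R K"
  unfolding K_def dot_def sum_three_cyclic[of _ 1]
  by (simp add: spin_simps scaleR_conv_of_real mult_2 algebra_simps)

lemma commutes_K: "p k * K = K * p k" "f * K = K * f"
  unfolding K_def dot_def sum_three_cyclic[of _ 1]
  by (simp_all add: spin_space spin_space[THEN mult_assoc_subst] f_commutes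
      f_commutes[THEN mult_assoc_subst] algebra_simps)

lemma Y_K: "Y * K = Y" "K * Y = Y"
  by (simp_all add: Y_def dot_def sum_distrib_left sum_distrib_right mult.assoc commutes_K S_K
       S_K[THEN mult_assoc_subst])

text \<open>In the squares the mixed terms cancel, since the spin products are antisymmetric in two
  distinct indices and the momentum products are symmetric.\<close>

lemma dot_p_square:
  "dot s p * dot s p = dot p p" "dot t p * dot t p = dot p p" "dot t p * dot s p = dot s p * dot t p"
  unfolding dot_def sum_three_cyclic[of _ 1]
  by (simp_all add: spin_simps p_p p_p[THEN commute_left_subst] spin_space spin_space[THEN mult_assoc_subst] algebra_simps)

lemma Y_square: "Y * Y = (1/2) *\<^sub>R (dot p p + dot s p * dot t p)"
proof -
  have "Y = (1/2) *\<^sub>R (dot s p + dot t p)"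
    by (simp add: Y_def S_def dot_def sum.distrib scaleR_sum_right algebra_simps)
  then show ?thesis
    by (simp add: algebra_simps dot_p_square flip: scaleR_add_left)
qed

text \<open>The potential terms regroup as \<open>f + (d - f) K = d + (d - f) (K - 1)\<close>; the
  remaining two terms are \<open>Y_square\<close>.\<close>

lemma H_eq: "H d = Y * Y + of_real d + (of_real d - f) * (K - 1)"
  by (simp add: H_def Y_square algebra_simps)

text \<open>By \<open>H_eq\<close>, the factor \<open>K + 3\<close> annihilates the part of
  \<open>H - d\<close> containing \<open>K - 1\<close> and multiplies \<open>Y\<close> by 4.\<close>

lemma Y_relation: "Y * Y = (1/4) *\<^sub>R ((H d - of_real d) * (K + 3 *\<^sub>R 1))"
proof -
  have "(K - 1) * (K + 3 *\<^sub>R 1) = 0"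
    using scaleR_add_left[of 1 2 K] by (simp add: algebra_simps K_square)
  then have "(H d - of_real d) * (K + 3 *\<^sub>R 1) = Y * (Y * (K + 3 *\<^sub>R 1))"
    by (simp add: H_eq distrib_right mult.assoc)
  also have "Y * (K + 3 *\<^sub>R 1) = 4 *\<^sub>R Y"
    using scaleR_add_left[of 1 3 Y] by (simp add: algebra_simps Y_K)
  finally show ?thesis
    by simp
qed

lemma H_commutes_K: "H d * K = K * H d"
  by (simp add: H_eq algebra_simps Y_K Y_K[THEN mult_assoc_subst] commutes_K commutes_K[THEN mult_assoc_subst] of_real_def)

lemma H_commutes_Y: "H d * Y = Y * H d"
proof -
  have Y: "(K - 1) * Y = 0" "Y * (K - 1) = 0"
    by (simp_all add: algebra_simps Y_K)
  have "(of_real d - f) * (K - 1) = (K - 1) * (of_real d - f)"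
    by (simp add: algebra_simps commutes_K of_real_def)
  then have "Y * ((of_real d - f) * (K - 1)) = Y * (K - 1) * (of_real d - f)"
    by (simp add: mult.assoc)
  also have "\<dots> = (of_real d - f) * ((K - 1) * Y)"
    by (simp add: Y)
  finally have "(of_real d - f) * ((K - 1) * Y) = Y * ((of_real d - f) * (K - 1))" ..
  then show ?thesis
    by (simp add: H_eq distrib_left distrib_right mult.assoc of_real_def)
qed

section \<open>Rotation invariance\<close>

lemma vector_under_J: "vector_under (hbar *\<^sub>R I) J x" "vector_under (hbar *\<^sub>R I) J p"
   "vector_under (hbar *\<^sub>R I) J s" "vector_under (hbar *\<^sub>R I) J t" "vector_under (hbar *\<^sub>R I) J J"
proof -
  show x: "vector_under (hbar *\<^sub>R I) J x" and p: "vector_under (hbar *\<^sub>R I) J p"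
    unfolding J_def[abs_def]
    by (rule vector_under_add_commuting;
        simp add: vector_under_def L_def cross_def p_x x_x p_p algebra_simps I_commutes spin_space
        p_x[THEN mult_assoc_subst] x_x[THEN commute_left_subst] p_p[THEN commute_left_subst]
        I_commutes[THEN mult_assoc_subst])+
  \<comment> \<open>Here the orbital part drops out. The commutator of two Pauli components carries
    a factor 2, which cancels the half in \<open>hbar / 2\<close>.\<close>
  show s: "vector_under (hbar *\<^sub>R I) J s" and t: "vector_under (hbar *\<^sub>R I) J t"
    unfolding vector_under_def J_def L_def cross_def
    by (simp_all add: spin_simps spin_space spin_space[THEN mult_assoc_subst] algebra_simps
        flip: scaleR_add_left)
  \<comment> \<open>\<open>J\<close> is assembled from the vectors \<open>x\<close>,
    \<open>p\<close>, \<open>s\<close>, \<open>t\<close> by a cross product, sums and scaling, so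
    its own commutation relations need no further computation.\<close>
  show "vector_under (hbar *\<^sub>R I) J J"
    using vector_under_add[OF vector_under_cross[OF x p]
        vector_under_scaleR[OF vector_under_add[OF s t], of "hbar / 2"]]
    unfolding L_def[symmetric] J_def[symmetric] .
qed

text \<open>Moving \<open>f\<close> past the momenta in \<open>L\<close> leaves the cross product of
  \<open>x\<close> with itself, multiplied by \<open>g0\<close>, and this vanishes because the
  \<open>x k\<close> commute.\<close>

lemma J_commutes_f: "J k * f = f * J k"
  unfolding J_def L_def cross_def
  by (simp add: f_commutes p_f g_commutes x_x algebra_simps f_commutes[THEN mult_assoc_subst]
     g_commutes[THEN mult_assoc_subst] x_x[THEN commute_left_subst])

lemma J_commutes_K: "J k * K = K * J k"
  unfolding K_def by (rule commutes_dot[OF vector_under_J(3,4)])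

lemma J_commutes_Y: "J k * Y = Y * J k"
  unfolding Y_def S_def[abs_def]
  by (intro commutes_dot[OF _ vector_under_J(2)] vector_under_scaleR vector_under_add vector_under_J)

lemma J_commutes_H: "J k * H d = H d * J k"
  unfolding H_eq
  by (simp add: algebra_simps J_commutes_Y J_commutes_K J_commutes_f of_real_def
       J_commutes_Y[THEN mult_assoc_subst] J_commutes_K[THEN mult_assoc_subst] J_commutes_f[THEN mult_assoc_subst])

lemma J_square_commutes:
  "dot J J * K = K * dot J J" "dot J J * Y = Y * dot J J" "dot J J * H d = H d * dot J J"
  "dot J J * J k = J k * dot J J"
  by (intro dot_self_commutes J_commutes_H J_commutes_K J_commutes_Y commutes_dot[OF vector_under_J(5,5), symmetric])+

end

section \<open>The algebra of operators on smooth waves\<close>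

text \<open>Since \<^const>\<open>op_eq\<close> ignores values at the origin, waves are normalised to vanish there: then
  operators that agree off the origin become equal elements of an algebra.\<close>

typedef smooth_wave = "{\<psi> :: wave. smooth_on (- {0}) \<psi> \<and> \<psi> 0 = 0}"
  by (rule exI[of _ "\<lambda>x. 0"]) (auto intro: smooth_on_const)

setup_lifting type_definition_smooth_wave

instantiation smooth_wave :: real_vector
begin

lift_definition zero_smooth_wave :: smooth_wave is "\<lambda>x. 0"
  by (auto intro: smooth_on_const)

lift_definition plus_smooth_wave :: "smooth_wave \<Rightarrow> smooth_wave \<Rightarrow> smooth_wave" is "\<lambda>\<psi> \<phi> x. \<psi> x + \<phi> x"
  by (auto intro: smooth_on_add)

lift_definition scaleR_smooth_wave :: "real \<Rightarrow> smooth_wave \<Rightarrow> smooth_wave" is "\<lambda>c \<psi> x. c *\<^sub>R \<psi> x"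
  by (auto intro: smooth_on_scaleR)

lift_definition uminus_smooth_wave :: "smooth_wave \<Rightarrow> smooth_wave" is "\<lambda>\<psi> x. - \<psi> x"
  by (auto intro: smooth_on_minus)

lift_definition minus_smooth_wave :: "smooth_wave \<Rightarrow> smooth_wave \<Rightarrow> smooth_wave" is "\<lambda>\<psi> \<phi> x. \<psi> x - \<phi> x"
  by (auto intro: smooth_on_diff)

instance
  by standard (transfer; simp add: fun_eq_iff algebra_simps)+

end

text \<open>Linearity makes composition distribute over sums in its right argument as well, as an
  algebra requires.\<close>

typedef wave_op = "{A :: smooth_wave \<Rightarrow> smooth_wave. linear A}"
  by (rule exI[of _ id]) (auto intro: linear_id)

setup_lifting type_definition_wave_op

instantiation wave_op :: real_algebra_1
begin

lift_definition zero_wave_op :: wave_op is "\<lambda>\<psi>. 0"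
  by (rule module_hom_zero)

lift_definition one_wave_op :: wave_op is "\<lambda>\<psi>. \<psi>"
  by (rule linear_ident)

lift_definition plus_wave_op :: "wave_op \<Rightarrow> wave_op \<Rightarrow> wave_op" is "\<lambda>A B \<psi>. A \<psi> + B \<psi>"
  by (rule linear_compose_add)

lift_definition minus_wave_op :: "wave_op \<Rightarrow> wave_op \<Rightarrow> wave_op" is "\<lambda>A B \<psi>. A \<psi> - B \<psi>"
  by (rule linear_compose_sub)

lift_definition uminus_wave_op :: "wave_op \<Rightarrow> wave_op" is "\<lambda>A \<psi>. - A \<psi>"
  by (rule linear_compose_neg)

lift_definition scaleR_wave_op :: "real \<Rightarrow> wave_op \<Rightarrow> wave_op" is "\<lambda>c A \<psi>. c *\<^sub>R A \<psi>"
  by (rule linear_compose_scale_right)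

lift_definition times_wave_op :: "wave_op \<Rightarrow> wave_op \<Rightarrow> wave_op" is "\<lambda>A B \<psi>. A (B \<psi>)"
  using Real_Vector_Spaces.linear_compose by (force simp: comp_def)

text \<open>Supplies the algebra axiom that 0 and 1 differ. The witness is a constant wave reset to
  0 at the origin.\<close>

lemma ex_nonzero_smooth_wave: "\<exists>\<psi> :: smooth_wave. \<psi> \<noteq> 0"
proof -
  have "smooth_on (- {0}) (\<lambda>x :: real ^ 3. if x = 0 then 0 else (\<chi> i. 1) :: complex ^ (2 \<times> 2))"
    by (rule smooth_on_cong[OF _ _ smooth_on_const[of _ "(\<chi> i. 1)"]]) auto
  moreover have "(\<lambda>x :: real ^ 3. if x = 0 then 0 else (\<chi> i. 1) :: complex ^ (2 \<times> 2)) \<noteq> (\<lambda>x. 0)"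
    by (auto simp: fun_eq_iff vec_eq_iff intro!: exI[of _ "\<chi> i. 1"])
  ultimately show ?thesis
    by transfer auto
qed

lemma linear_Rep_wave_op: "linear (Rep_wave_op A)"
  using Rep_wave_op by simp

instance
proof
  obtain \<psi> :: smooth_wave where "\<psi> \<noteq> 0"
    using ex_nonzero_smooth_wave by blast
  then have "Rep_wave_op 0 \<psi> \<noteq> Rep_wave_op 1 \<psi>"
    by (simp add: zero_wave_op.rep_eq one_wave_op.rep_eq)
  then show "(0::wave_op) \<noteq> 1"
    by metis
qed (simp_all add: Rep_wave_op_inject[symmetric] fun_eq_iff zero_wave_op.rep_eq one_wave_op.rep_eq
    plus_wave_op.rep_eq minus_wave_op.rep_eq uminus_wave_op.rep_eq scaleR_wave_op.rep_eq
    times_wave_op.rep_eq linear_add[OF linear_Rep_wave_op] linear_scale[OF linear_Rep_wave_op]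
    algebra_simps)

end

section \<open>Representing operators by elements of the algebra\<close>

definition agrees :: "wave \<Rightarrow> smooth_wave \<Rightarrow> bool" where
  "agrees \<psi> \<Psi> \<longleftrightarrow> (\<forall>x\<in>- {0}. \<psi> x = Rep_smooth_wave \<Psi> x)"

text \<open>Allowing every wave that agrees with \<open>\<Psi>\<close>, whatever its value at the
  origin, makes the relation stable under composition: the image of a wave need not vanish
  there.\<close>

definition represents :: "oper \<Rightarrow> wave_op \<Rightarrow> bool" where
  "represents A a \<longleftrightarrow> (\<forall>\<psi> \<Psi>. agrees \<psi> \<Psi> \<longrightarrow> agrees (A \<psi>) (Rep_wave_op a \<Psi>))"

lemma smooth_on_Rep_smooth_wave: "smooth_on (- {0}) (Rep_smooth_wave \<Psi>)"
  using Rep_smooth_wave by simp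

lemma agrees_Rep: "agrees (Rep_smooth_wave \<Psi>) \<Psi>"
  by (simp add: agrees_def)

lemma agrees_unique: "agrees \<psi> \<Psi> \<Longrightarrow> agrees \<psi> \<Phi> \<Longrightarrow> \<Psi> = \<Phi>"
proof -
  assume "agrees \<psi> \<Psi>" "agrees \<psi> \<Phi>"
  moreover have "Rep_smooth_wave \<Psi> 0 = Rep_smooth_wave \<Phi> 0"
    using Rep_smooth_wave by (metis (mono_tags, lifting) mem_Collect_eq)
  ultimately have "Rep_smooth_wave \<Psi> x = Rep_smooth_wave \<Phi> x" for x
    by (cases "x = 0") (auto simp: agrees_def)
  then show ?thesis
    by (simp add: fun_eq_iff flip: Rep_smooth_wave_inject)
qed

definition smooth_wave_of :: "wave \<Rightarrow> smooth_wave" where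
  "smooth_wave_of \<psi> = Abs_smooth_wave (\<lambda>x. if x = 0 then 0 else \<psi> x)"

lemma agrees_smooth_wave_of:
  assumes "smooth_on (- {0}) \<psi>"
  shows "agrees \<psi> (smooth_wave_of \<psi>)"
proof -
  have "smooth_on (- {0}) (\<lambda>x. if x = 0 then 0 else \<psi> x)"
    by (rule smooth_on_cong[OF _ _ assms]) auto
  then show ?thesis
    by (simp add: agrees_def smooth_wave_of_def Abs_smooth_wave_inverse)
qed

lemma op_eq_if_represents:
  assumes "represents A a" "represents B a"
  shows "op_eq A B"
  using assms agrees_smooth_wave_of unfolding op_eq_def represents_def agrees_def by metis

text \<open>While \<open>op_eq_if_represents\<close> carries identities from the algebra to
  operators, this goes the other way: relations in the algebra are proved by evaluating operators
  off the origin.\<close>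

lemma represents_unique:
  assumes "represents A a" "represents B b" "op_eq A B"
  shows "a = b"
proof -
  have "Rep_wave_op a \<Psi> = Rep_wave_op b \<Psi>" for \<Psi>
  proof (rule agrees_unique)
    show "agrees (A (Rep_smooth_wave \<Psi>)) (Rep_wave_op a \<Psi>)"
      using assms(1) agrees_Rep unfolding represents_def by blast
    have "agrees (B (Rep_smooth_wave \<Psi>)) (Rep_wave_op b \<Psi>)"
      using assms(2) agrees_Rep unfolding represents_def by blast
    then show "agrees (A (Rep_smooth_wave \<Psi>)) (Rep_wave_op b \<Psi>)"
      using assms(3) smooth_on_Rep_smooth_wave unfolding op_eq_def agrees_def by simp
  qed
  then show ?thesis
    by (simp add: fun_eq_iff flip: Rep_wave_op_inject)
qed

lemma represents_comp: "represents A a \<Longrightarrow> represents B b \<Longrightarrow> represents (A \<circ> B) (a * b)"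
  by (simp add: represents_def times_wave_op.rep_eq)

lemma represents_plus: "represents A a \<Longrightarrow> represents B b \<Longrightarrow> represents (A + B) (a + b)"
  by (simp add: represents_def agrees_def plus_wave_op.rep_eq plus_smooth_wave.rep_eq) metis

lemma represents_minus: "represents A a \<Longrightarrow> represents B b \<Longrightarrow> represents (A - B) (a - b)"
  by (simp add: represents_def agrees_def minus_wave_op.rep_eq minus_smooth_wave.rep_eq) metis

lemma represents_zero: "represents 0 0"
  by (simp add: represents_def agrees_def zero_wave_op.rep_eq zero_smooth_wave.rep_eq)

lemma represents_id: "represents id 1"
  by (simp add: represents_def one_wave_op.rep_eq)

lemma represents_scale: "represents A a \<Longrightarrow> represents (op_scale c A) (c *\<^sub>R a)"
  by (simp add: represents_def agrees_def op_scale_def scaleR_wave_op.rep_eq scaleR_smooth_wave.rep_eq)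

lemma represents_sum:
  "(\<And>i. i \<in> I \<Longrightarrow> represents (A i) (a i)) \<Longrightarrow> represents (\<Sum>i\<in>I. A i) (\<Sum>i\<in>I. a i)"
  by (induction I rule: infinite_finite_induct) (simp_all add: represents_zero represents_plus)

text \<open>The second clause says that the result off the origin does not depend on the argument at
  the origin. It is what permits replacing a wave by its normalised version.\<close>

definition smooth_linear :: "oper \<Rightarrow> bool" where
  "smooth_linear A \<longleftrightarrow>
    (\<forall>\<psi>. smooth_on (- {0}) \<psi> \<longrightarrow> smooth_on (- {0}) (A \<psi>)) \<and>
    (\<forall>\<psi> \<phi>. \<forall>x\<in>- {0}. (\<forall>y\<in>- {0}. \<psi> y = \<phi> y) \<longrightarrow> A \<psi> x = A \<phi> x) \<and>
    (\<forall>\<psi> \<phi>. \<forall>x\<in>- {0}. smooth_on (- {0}) \<psi> \<longrightarrow> smooth_on (- {0}) \<phi> \<longrightarrow>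
      A (\<lambda>y. \<psi> y + \<phi> y) x = A \<psi> x + A \<phi> x) \<and>
    (\<forall>c \<psi>. \<forall>x\<in>- {0}. smooth_on (- {0}) \<psi> \<longrightarrow> A (\<lambda>y. c *\<^sub>R \<psi> y) x = c *\<^sub>R A \<psi> x)"

definition wave_op_of :: "oper \<Rightarrow> wave_op" where
  "wave_op_of A = Abs_wave_op (\<lambda>\<Psi>. smooth_wave_of (A (Rep_smooth_wave \<Psi>)))"

lemma represents_wave_op_of:
  assumes "smooth_linear A"
  shows "represents A (wave_op_of A)"
proof -
  define F where "F \<Psi> = smooth_wave_of (A (Rep_smooth_wave \<Psi>))" for \<Psi>
  have F: "agrees (A (Rep_smooth_wave \<Psi>)) (F \<Psi>)" for \<Psi>
    using assms smooth_on_Rep_smooth_wave unfolding F_def smooth_linear_def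
    by (blast intro: agrees_smooth_wave_of)
  have "linear F"
  proof (rule linearI)
    show "F (\<Psi> + \<Phi>) = F \<Psi> + F \<Phi>" for \<Psi> \<Phi>
    proof (rule agrees_unique[OF F])
      show "agrees (A (Rep_smooth_wave (\<Psi> + \<Phi>))) (F \<Psi> + F \<Phi>)"
        using assms smooth_on_Rep_smooth_wave F[of \<Psi>] F[of \<Phi>]
        unfolding smooth_linear_def agrees_def plus_smooth_wave.rep_eq by simp
    qed
    show "F (c *\<^sub>R \<Psi>) = c *\<^sub>R F \<Psi>" for c \<Psi>
    proof (rule agrees_unique[OF F])
      show "agrees (A (Rep_smooth_wave (c *\<^sub>R \<Psi>))) (c *\<^sub>R F \<Psi>)"
        using assms smooth_on_Rep_smooth_wave F[of \<Psi>]
        unfolding smooth_linear_def agrees_def scaleR_smooth_wave.rep_eq by simp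
    qed
  qed
  then have "Rep_wave_op (wave_op_of A) = F"
    by (simp add: wave_op_of_def Abs_wave_op_inverse flip: F_def)
  moreover have "A \<psi> x = A (Rep_smooth_wave \<Psi>) x" if "agrees \<psi> \<Psi>" "x \<noteq> 0" for \<psi> \<Psi> x
    using assms that unfolding smooth_linear_def agrees_def by auto
  ultimately show ?thesis
    using F by (simp add: represents_def agrees_def)
qed

lemma matrix_vector_mult_scaleR: "(M :: complex ^ 'n ^ 'm) *v (c *\<^sub>R v) = c *\<^sub>R (M *v v)"
  by (rule linear_scale[OF bounded_linear.linear[OF matrix_vector_mul_bounded_linear]])

lemma smooth_linear_matrix_op: "smooth_linear (matrix_op M)"
  unfolding smooth_linear_def matrix_op_def
  by (auto simp: open_Compl smooth_on_bounded_linear[OF _ matrix_vector_mul_bounded_linear]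
      matrix_vector_right_distrib matrix_vector_mult_scaleR)

lemma smooth_linear_mult_op: "smooth_on (- {0}) g \<Longrightarrow> smooth_linear (mult_op g)"
  unfolding smooth_linear_def mult_op_def
  by (auto simp: open_Compl smooth_on_bounded_bilinear[OF _ bounded_bilinear_scaleR] algebra_simps)

lemma smooth_linear_partial: "smooth_linear (partial k)"
  unfolding smooth_linear_def
proof (intro conjI allI impI ballI)
  fix \<psi> \<phi> :: wave and x :: "real ^ 3" and c :: real
  assume x: "x \<in> - {0}"
  show "\<forall>y\<in>- {0}. \<psi> y = \<phi> y \<Longrightarrow> partial k \<psi> x = partial k \<phi> x"
    unfolding partial_def using frechet_derivative_cong_open[OF _ x] by (metis open_Compl closed_singleton)
  assume \<psi>: "smooth_on (- {0}) \<psi>"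
  note d = smooth_on_imp_has_derivative[OF \<psi> x]
  show "partial k (\<lambda>y. c *\<^sub>R \<psi> y) x = c *\<^sub>R partial k \<psi> x"
    unfolding partial_def
    by (simp add: frechet_derivative_at[OF has_derivative_scaleR_right[OF d], symmetric])
  assume \<phi>: "smooth_on (- {0}) \<phi>"
  show "partial k (\<lambda>y. \<psi> y + \<phi> y) x = partial k \<psi> x + partial k \<phi> x"
    unfolding partial_def
    by (simp add: frechet_derivative_at[OF has_derivative_add[OF d
          smooth_on_imp_has_derivative[OF \<phi> x]], symmetric])
qed (simp add: partial_def smooth_on_frechet_derivative)

section \<open>Multiplication, matrix and differentiation operators\<close>

definition mul :: "(real ^ 3 \<Rightarrow> real) \<Rightarrow> wave_op" where
  "mul g = wave_op_of (mult_op g)"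

definition mtx :: "complex ^ (2 \<times> 2) ^ (2 \<times> 2) \<Rightarrow> wave_op" where
  "mtx M = wave_op_of (matrix_op M)"

definition dif :: "3 \<Rightarrow> wave_op" where
  "dif k = wave_op_of (partial k)"

lemma represents_mul: "smooth_on (- {0}) g \<Longrightarrow> represents (mult_op g) (mul g)"
  unfolding mul_def by (intro represents_wave_op_of smooth_linear_mult_op)

lemma represents_mtx: "represents (matrix_op M) (mtx M)"
  unfolding mtx_def by (intro represents_wave_op_of smooth_linear_matrix_op)

lemma represents_dif: "represents (partial k) (dif k)"
  unfolding dif_def by (intro represents_wave_op_of smooth_linear_partial)

lemma mtx_mtx: "mtx M * mtx N = mtx (M ** N)"
  by (rule represents_unique[OF represents_comp[OF represents_mtx represents_mtx] represents_mtx])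
     (simp add: op_eq_def matrix_op_def matrix_vector_mul_assoc)

lemma mtx_one: "mtx (mat 1) = 1"
  by (rule represents_unique[OF represents_mtx represents_id]) (simp add: op_eq_def matrix_op_def)

lemma mtx_minus: "mtx (- M) = - mtx M"
proof -
  have "mtx (- M) = 0 - mtx M"
    by (rule represents_unique[OF represents_mtx represents_minus[OF represents_zero represents_mtx]])
       (simp add: op_eq_def matrix_op_def matrix_vector_mult_def vec_eq_iff sum_negf)
  then show ?thesis by simp
qed

lemma mtx_mul: "smooth_on (- {0}) g \<Longrightarrow> mtx M * mul g = mul g * mtx M"
  by (rule represents_unique[OF represents_comp[OF represents_mtx represents_mul]
        represents_comp[OF represents_mul represents_mtx]])
     (simp_all add: op_eq_def matrix_op_def mult_op_def matrix_vector_mult_scaleR)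

lemma mul_mul_commute:
  "smooth_on (- {0}) g \<Longrightarrow> smooth_on (- {0}) h \<Longrightarrow> mul g * mul h = mul h * mul g"
  by (rule represents_unique[OF represents_comp[OF represents_mul represents_mul]
        represents_comp[OF represents_mul represents_mul]])
     (simp_all add: op_eq_def mult_op_def)

lemma mul_mul:
  "smooth_on (- {0}) g \<Longrightarrow> smooth_on (- {0}) h \<Longrightarrow> mul g * mul h = mul (\<lambda>x. g x * h x)"
  by (rule represents_unique[OF represents_comp[OF represents_mul represents_mul] represents_mul])
     (simp_all add: op_eq_def mult_op_def open_Compl smooth_on_bounded_bilinear[OF _ bounded_bilinear_mult])

lemma mul_const: "mul (\<lambda>x. c) = c *\<^sub>R 1"
  by (rule represents_unique[OF represents_mul represents_scale[OF represents_id]])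
     (auto simp: op_eq_def mult_op_def op_scale_def intro: smooth_on_const)

lemma dif_dif: "dif j * dif k = dif k * dif j"
  by (rule represents_unique[OF represents_comp[OF represents_dif represents_dif]
        represents_comp[OF represents_dif represents_dif]])
     (auto simp: op_eq_def partial_def intro: symmetric_second_derivative)

lemma dif_mtx: "dif k * mtx M = mtx M * dif k"
proof (rule represents_unique[OF represents_comp[OF represents_dif represents_mtx]
        represents_comp[OF represents_mtx represents_dif]])
  show "op_eq (partial k \<circ> matrix_op M) (matrix_op M \<circ> partial k)"
    unfolding op_eq_def partial_def matrix_op_def comp_def
    by (auto simp: frechet_derivative_at[OF bounded_linear.has_derivative[OF
          matrix_vector_mul_bounded_linear smooth_on_imp_has_derivative], symmetric])
qed

text \<open>The product rule. Coordinates in the role of \<open>g\<close> give the canonical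
  commutation relations, and the radial potential gives the relation \<open>p_f\<close>.\<close>

lemma dif_mul:
  assumes g: "smooth_on (- {0}) g"
  shows "dif k * mul g = mul g * dif k + mul (\<lambda>x. frechet_derivative g (at x) (axis k 1))"
proof (rule represents_unique[OF represents_comp[OF represents_dif represents_mul[OF g]]
        represents_plus[OF represents_comp[OF represents_mul[OF g] represents_dif]
         represents_mul[OF smooth_on_frechet_derivative[OF g]]]])
  show "op_eq (partial k \<circ> mult_op g)
     ((mult_op g \<circ> partial k) + mult_op (\<lambda>x. frechet_derivative g (at x) (axis k 1)))"
    unfolding op_eq_def partial_def mult_op_def comp_def
    by (auto simp: frechet_derivative_at[OF has_derivative_scaleR[OF
          smooth_on_imp_has_derivative[OF g] smooth_on_imp_has_derivative], symmetric])
qed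

lemma mul_cong:
  assumes "smooth_on (- {0}) g" "\<And>x. x \<noteq> 0 \<Longrightarrow> g x = h x"
  shows "mul g = mul h"
proof (rule represents_unique[OF represents_mul represents_mul])
  show "smooth_on (- {0}) h"
    by (rule smooth_on_cong[OF _ _ assms(1)]) (auto simp: assms(2))
qed (use assms in \<open>auto simp: op_eq_def mult_op_def\<close>)

section \<open>Kronecker products and Pauli matrices\<close>

lemma kronecker_mult: "kronecker A B ** kronecker C D = kronecker (A ** C) (B ** D)"
  by (simp add: vec_eq_iff kronecker_def matrix_matrix_mult_def sum_product mult_ac
      sum.cartesian_product case_prod_unfold flip: UNIV_Times_UNIV)

lemma kronecker_one: "kronecker (mat 1) (mat 1) = mat 1"
  by (auto simp: vec_eq_iff kronecker_def mat_def)

text \<open>A scalar may be placed in either tensor factor. Thus a single element for the imaginary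
  unit serves the Pauli relations of both spins.\<close>

lemma kronecker_mat: "kronecker (mat c) (mat 1) = mat c" "kronecker (mat 1) (mat c) = mat c"
  by (auto simp: vec_eq_iff kronecker_def mat_def)

lemma kronecker_minus: "kronecker (- A) B = - kronecker A B" "kronecker A (- B) = - kronecker A B"
  by (simp_all add: vec_eq_iff kronecker_def)

lemma mat_mult: "mat c ** (M :: 'a::comm_semiring_1 ^ 'n ^ 'n) = M ** mat c"
  by (simp add: vec_eq_iff matrix_matrix_mult_def mat_def mult_delta_left mult_delta_right mult.commute)

lemma mat_mult_mat: "mat c ** (mat d :: 'a::comm_semiring_1 ^ 'n ^ 'n) = mat (c * d)"
  by (simp add: vec_eq_iff matrix_matrix_mult_def mat_def mult_delta_left mult_delta_right)

lemma next3_simps: "(1::3) + 1 = 2" "(2::3) + 1 = 3" "(3::3) + 1 = 1"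
 "(1::3) + 2 = 3" "(2::3) + 2 = 1" "(3::3) + 2 = 2"
  by simp_all

lemma pauli_mult:
  "pauli k ** pauli k = mat 1"
  "pauli k ** pauli (k + 1) = mat \<i> ** pauli (k + 2)"
  "pauli (k + 1) ** pauli k = - (mat \<i> ** pauli (k + 2))"
proof -
  have "k = 1 \<or> k = 2 \<or> k = 3"
    by (rule exhaust_3)
  then show "pauli k ** pauli k = mat 1"
    "pauli k ** pauli (k + 1) = mat \<i> ** pauli (k + 2)"
    "pauli (k + 1) ** pauli k = - (mat \<i> ** pauli (k + 2))"
    by (elim disjE; simp only: next3_simps; simp add: pauli_def vec_eq_iff matrix_matrix_mult_def
        mat_def forall_2 sum_2 vector_2)+
qed

section \<open>Commuting integrals of motion\<close>

lemma op_cross_cyclic: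
  "op_cross A B k = (A (next3 k) \<circ> B (prev3 k)) - (A (prev3 k) \<circ> B (next3 k))"
proof -
  have "k = 1 \<or> k = 2 \<or> k = 3"
    by (rule exhaust_3)
  then show ?thesis
    unfolding next3_def prev3_def by (elim disjE; simp only: next3_simps; simp add: op_cross_def)
qed

lemma represents_op_inner:
  "(\<And>k. represents (A k) (a k)) \<Longrightarrow> (\<And>k. represents (B k) (b k)) \<Longrightarrow> represents (op_inner A B) (dot a b)"
  unfolding op_inner_def dot_def by (intro represents_sum represents_comp)

lemma represents_op_cross:
  "(\<And>k. represents (A k) (a k)) \<Longrightarrow> (\<And>k. represents (B k) (b k)) \<Longrightarrow> represents (op_cross A B k) (cross a b k)"
  unfolding op_cross_cyclic cross_def by (intro represents_minus represents_comp)

lemma commutator_eq_zero: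
  assumes "represents A a" "represents B b" "a * b = b * a"
  shows "op_eq (commutator A B) 0"
  using op_eq_if_represents[OF represents_minus[OF represents_comp[OF assms(1,2)]
        represents_comp[OF assms(2,1)]]] represents_zero assms(3)
  by (simp add: commutator_def)

section \<open>Position, momentum and spin as elements of the algebra\<close>

definition pos :: "3 \<Rightarrow> wave_op" where "pos k = mul (\<lambda>x. x $ k)"
text \<open>The algebra is real, so multiplication by the imaginary unit has to be an element of
  it.\<close>

definition imag :: wave_op where "imag = mtx (mat \<i>)"
definition mom :: "real \<Rightarrow> 3 \<Rightarrow> wave_op" where "mom hbar k = (- hbar) *\<^sub>R (imag * dif k)"
definition spin1 :: "3 \<Rightarrow> wave_op" where "spin1 k = mtx (kronecker (pauli k) (mat 1))"
definition spin2 :: "3 \<Rightarrow> wave_op" where "spin2 k = mtx (kronecker (mat 1) (pauli k))"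

lemma smooth_on_nth: "smooth_on (- {0}) (\<lambda>x :: real ^ 'n. x $ k)"
  by (rule smooth_on_bounded_linear[OF _ bounded_linear_vec_nth smooth_on_ident]) auto

lemma represents_pos: "represents (position k) (pos k)"
  unfolding position_def pos_def by (intro represents_mul smooth_on_nth)

lemma represents_spin: "represents (sigma1 k) (spin1 k)" "represents (sigma2 k) (spin2 k)"
  unfolding sigma1_def spin1_def sigma2_def spin2_def by (rule represents_mtx)+

lemma represents_mom: "represents (momentum hbar k) (mom hbar k)"
proof -
  have "momentum hbar k = op_scale (- hbar) (matrix_op (mat \<i>) \<circ> partial k)"
    unfolding momentum_def op_scale_def matrix_op_def comp_def fun_eq_iff
    by (simp add: vec_eq_iff matrix_vector_mult_def mat_def mult_delta_left)
       (simp add: scaleR_conv_of_real)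
  then show ?thesis
    unfolding mom_def imag_def
    using represents_scale[OF represents_comp[OF represents_mtx represents_dif]] by metis
qed

lemma imag_square: "imag * imag = - 1"
proof -
  have "mat (- 1) = - (mat 1 :: complex ^ (2 \<times> 2) ^ (2 \<times> 2))"
    by (simp add: vec_eq_iff mat_def)
  then show ?thesis
    by (simp add: imag_def mtx_mtx mat_mult_mat mtx_minus mtx_one)
qed

lemma dif_imag: "dif k * imag = imag * dif k"
  by (simp add: imag_def dif_mtx)

text \<open>Yields both the commutation of the momenta and the identification of
  \<open>p^2 / 2\<close> with the Laplacian term of the Hamiltonian.\<close>

lemma mom_mom: "mom hbar j * mom hbar k = (- hbar\<^sup>2) *\<^sub>R (dif j * dif k)"
  by (simp add: mom_def mult.assoc dif_imag[THEN mult_assoc_subst] imag_square[THEN mult_assoc_subst]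
      power2_eq_square)

text \<open>By the chain rule the gradient of \<open>V0(|x|)\<close> is \<open>x\<close> times
  \<open>g = V0'(r) / r\<close>. Multiplying by \<open>- \<i> hbar\<close> gives the element that
  plays the role of \<open>g0\<close>.\<close>

lemma two_spin_particle_wave_op:
  fixes V0 :: "real \<Rightarrow> real"
  assumes V0: "smooth_on {0<..} V0"
  defines "g \<equiv> \<lambda>x :: real ^ 3. inverse (norm x) * frechet_derivative V0 (at (norm x)) 1"
  shows "two_spin_particle hbar imag (mul (\<lambda>x. V0 (norm x))) ((- hbar) *\<^sub>R (imag * mul g))
    pos (mom hbar) spin1 spin2"
proof -
  have V: "smooth_on (- {0}) (\<lambda>x :: real ^ 3. V0 (norm x))"
    by (rule smooth_on_compose_norm[OF V0])
  have g: "smooth_on (- {0}) g"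
    unfolding g_def
    by (rule smooth_on_compose_norm[OF smooth_on_bounded_bilinear[OF _ bounded_bilinear_mult
         smooth_on_inverse smooth_on_frechet_derivative[OF V0]]]) simp
  note x = smooth_on_nth[where 'n = 3]
  have imag_mul: "mul h * imag = imag * mul h" if "smooth_on (- {0}) h" for h
    using that by (simp add: imag_def mtx_mul)
  have imag_pos: "pos k * imag = imag * pos k" for k
    unfolding pos_def by (rule imag_mul[OF x])
  have imag_spin1: "spin1 k * imag = imag * spin1 k" and imag_spin2: "spin2 k * imag = imag * spin2 k" for k
    by (simp_all add: imag_def spin1_def spin2_def mtx_mtx mat_mult)
  have spin_dif: "spin1 j * dif k = dif k * spin1 j" "spin2 j * dif k = dif k * spin2 j" for j k
    by (simp_all add: spin1_def spin2_def dif_mtx)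
  have dif_x: "dif j * pos k = pos k * dif j + (if j = k then 1 else 0)" for j k
  proof -
    have "frechet_derivative (\<lambda>x :: real ^ 3. x $ k) (at x) = (\<lambda>v. v $ k)" for x
      by (metis bounded_linear_imp_has_derivative[OF bounded_linear_vec_nth] frechet_derivative_at)
    then show ?thesis
      unfolding pos_def
      by (simp add: dif_mul[OF x] axis_def) (simp add: mul_const)
  qed
  have dif_V: "dif k * mul (\<lambda>x. V0 (norm x)) = mul (\<lambda>x. V0 (norm x)) * dif k + pos k * mul g" for k
  proof -
    \<comment> \<open>The chain rule is applied off the origin only, which \<open>mul_cong\<close>
      accepts.\<close>
    have "mul (\<lambda>x. frechet_derivative (\<lambda>x. V0 (norm x)) (at x) (axis k 1)) = mul (\<lambda>x. x $ k * g x)"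
    proof (rule mul_cong)
      show "frechet_derivative (\<lambda>x. V0 (norm x)) (at x) (axis k 1) = x $ k * g x"
        if "x \<noteq> 0" for x :: "real ^ 3"
        by (simp add: frechet_derivative_at[OF has_derivative_compose_norm[OF V0 that], symmetric]
            g_def inner_axis')
    qed (rule smooth_on_frechet_derivative[OF V])
    then show ?thesis
      by (simp add: dif_mul[OF V] pos_def mul_mul[OF x g])
  qed
  show ?thesis
  proof
    fix j k
    show "imag * imag = - 1" by (rule imag_square)
    show "pos k * imag = imag * pos k"
      by (rule imag_pos)
    show "mom hbar k * imag = imag * mom hbar k"
      by (simp add: mom_def dif_imag mult.assoc)
    show "spin1 k * imag = imag * spin1 k" "spin2 k * imag = imag * spin2 k"
      by (rule imag_spin1 imag_spin2)+
    show "pos j * pos k = pos k * pos j"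
      unfolding pos_def by (rule mul_mul_commute[OF x x])
    show "mom hbar j * mom hbar k = mom hbar k * mom hbar j"
      by (simp add: mom_mom dif_dif)
    show "mom hbar j * pos k = pos k * mom hbar j - (if j = k then hbar *\<^sub>R imag else 0)"
      unfolding mom_def
      by (simp add: mult.assoc dif_x algebra_simps imag_pos[THEN mult_assoc_subst])
    \<comment> \<open>Written as a Kronecker product with the scalar in the factor where the spin
      acts, \<open>imag\<close> reduces each relation to one between 2 by 2 matrices.\<close>
    have imag: "imag = mtx (kronecker (mat \<i>) (mat 1))" "imag = mtx (kronecker (mat 1) (mat \<i>))"
      by (simp_all add: imag_def kronecker_mat)
    show "spin1 k * spin1 k = 1"
      "spin1 k * spin1 (next3 k) = imag * spin1 (prev3 k)"
      "spin1 (next3 k) * spin1 k = - (imag * spin1 (prev3 k))"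
      unfolding imag(1) spin1_def
      by (simp_all add: mtx_mtx kronecker_mult pauli_mult kronecker_one mtx_one
          next3_def prev3_def kronecker_minus mtx_minus)
    show "spin2 k * spin2 k = 1"
      "spin2 k * spin2 (next3 k) = imag * spin2 (prev3 k)"
      "spin2 (next3 k) * spin2 k = - (imag * spin2 (prev3 k))"
      unfolding imag(2) spin2_def
      by (simp_all add: mtx_mtx kronecker_mult pauli_mult kronecker_one mtx_one
          next3_def prev3_def kronecker_minus mtx_minus)
    show "spin2 j * spin1 k = spin1 k * spin2 j"
      by (simp add: spin1_def spin2_def mtx_mtx kronecker_mult)
    show "spin1 j * pos k = pos k * spin1 j" "spin2 j * pos k = pos k * spin2 j"
      unfolding spin1_def spin2_def pos_def by (rule mtx_mul[OF x])+
    show "spin1 j * mom hbar k = mom hbar k * spin1 j" "spin2 j * mom hbar k = mom hbar k * spin2 j"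
      by (simp_all add: mom_def mult.assoc imag_spin1[THEN mult_assoc_subst]
          imag_spin2[THEN mult_assoc_subst] flip: spin_dif)
  next
    fix k
    show "mul (\<lambda>x. V0 (norm x)) * pos k = pos k * mul (\<lambda>x. V0 (norm x))"
      unfolding pos_def by (rule mul_mul_commute[OF V x])
    show "mul (\<lambda>x. V0 (norm x)) * spin1 k = spin1 k * mul (\<lambda>x. V0 (norm x))"
      "mul (\<lambda>x. V0 (norm x)) * spin2 k = spin2 k * mul (\<lambda>x. V0 (norm x))"
      unfolding spin1_def spin2_def by (rule mtx_mul[OF V, symmetric])+
    show "mom hbar k * mul (\<lambda>x. V0 (norm x)) =
        mul (\<lambda>x. V0 (norm x)) * mom hbar k + pos k * ((- hbar) *\<^sub>R (imag * mul g))"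
      unfolding mom_def
      by (simp add: mult.assoc dif_V algebra_simps imag_pos[THEN mult_assoc_subst]
          imag_mul[OF V, THEN mult_assoc_subst])
    show "(- hbar) *\<^sub>R (imag * mul g) * pos k = pos k * (- hbar) *\<^sub>R (imag * mul g)"
      unfolding pos_def
      by (simp add: mult.assoc mul_mul_commute[OF g x] imag_mul[OF x, THEN mult_assoc_subst])
  qed
qed

theorem proposition6:
  fixes hbar d9 :: real and V0 :: "real \<Rightarrow> real"
  assumes "hbar > 0"
    and "smooth_on {0<..} V0"
  shows "let H = hamiltonian hbar V0 d9; K = K_op; Y = Y_op hbar;
             J2 = J_squared hbar; J3 = total_J hbar 3
         in commutator H J2 \<approx> 0 \<and> commutator H J3 \<approx> 0 \<and> commutator J2 J3 \<approx> 0 \<and>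
            commutator H Y \<approx> 0 \<and> commutator H K \<approx> 0 \<and> commutator K Y \<approx> 0 \<and>
            commutator J2 Y \<approx> 0 \<and> commutator J3 Y \<approx> 0 \<and>
            commutator J2 K \<approx> 0 \<and> commutator J3 K \<approx> 0 \<and>
            Y \<circ> Y \<approx> op_scale (1 / 4) ((H - op_scale d9 id) \<circ> (K + op_scale 3 id))"
proof -
  define f where "f = mul (\<lambda>x. V0 (norm x))"
  interpret two_spin_particle hbar imag f
    "(- hbar) *\<^sub>R (imag * mul (\<lambda>x :: real ^ 3. inverse (norm x) * frechet_derivative V0 (at (norm x)) 1))"
    pos "mom hbar" spin1 spin2
    unfolding f_def by (rule two_spin_particle_wave_op[OF assms(2)])
  \<comment> \<open>From here each concrete operator is matched with its abstract counterpart, after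
    which every claim is an identity of the algebra.\<close>
  have rJ: "represents (total_J hbar k) (J k)" for k
    unfolding total_J_def orbital_def J_def L_def
    by (intro represents_plus represents_scale represents_op_cross represents_pos represents_mom
        represents_spin)
  have rJ2: "represents (J_squared hbar) (dot J J)"
    unfolding J_squared_def by (intro represents_op_inner rJ)
  have rK: "represents K_op K"
    unfolding K_op_def K_def by (intro represents_op_inner represents_spin)
  have rY: "represents (Y_op hbar) Y"
  proof -
    have "Y = (1/2) *\<^sub>R dot (\<lambda>k. spin1 k + spin2 k) (mom hbar)"
      by (simp add: Y_def S_def dot_def scaleR_sum_right)
    then show ?thesis
      unfolding Y_op_def
      by (auto intro!: represents_scale represents_op_inner represents_plus represents_spin represents_mom)
  qed
  have rf: "represents (mult_op (\<lambda>x. V0 (norm x))) f"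
    unfolding f_def by (intro represents_mul smooth_on_compose_norm assms(2))
  have rdf: "represents (mult_op (\<lambda>x. d9 - V0 (norm x))) (of_real d9 - f)"
  proof -
    have "mult_op (\<lambda>x. d9 - V0 (norm x)) = op_scale d9 id - mult_op (\<lambda>x. V0 (norm x))"
      by (simp add: fun_eq_iff mult_op_def op_scale_def scaleR_left_diff_distrib)
    then show ?thesis
      unfolding of_real_def using represents_minus[OF represents_scale[OF represents_id] rf] by simp
  qed
  have rH: "represents (hamiltonian hbar V0 d9) (H d9)"
  proof -
    \<comment> \<open>The concrete kinetic term is a Laplacian and the abstract one is
      \<open>p^2 / 2\<close>; the former is represented through sums of
      \<open>dif k * dif k\<close>.\<close>
    have "(1/2) *\<^sub>R dot (mom hbar) (mom hbar) = (- (hbar\<^sup>2 / 2)) *\<^sub>R (\<Sum>k\<in>UNIV. dif k * dif k)"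
      by (simp add: dot_def mom_mom scaleR_sum_right sum_negf)
    then have H: "H d9 = (- (hbar\<^sup>2 / 2)) *\<^sub>R (\<Sum>k\<in>UNIV. dif k * dif k) + f + (of_real d9 - f) * K +
        (1/2) *\<^sub>R (dot spin1 (mom hbar) * dot spin2 (mom hbar))"
      by (simp add: H_def)
    show ?thesis
      unfolding hamiltonian_def H laplacian_def
      by (intro represents_plus represents_scale represents_comp represents_sum represents_dif
          rf rdf rK represents_op_inner represents_spin represents_mom)
  qed
  have r3: "represents (K_op + op_scale 3 id) (K + 3 *\<^sub>R 1)"
    by (intro represents_plus rK represents_scale represents_id)
  have rHd: "represents (hamiltonian hbar V0 d9 - op_scale d9 id) (H d9 - of_real d9)"
    unfolding of_real_def by (intro represents_minus rH represents_scale represents_id)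
  have "op_eq (Y_op hbar \<circ> Y_op hbar) (op_scale (1 / 4)
      ((hamiltonian hbar V0 d9 - op_scale d9 id) \<circ> (K_op + op_scale 3 id)))"
    using op_eq_if_represents[OF represents_comp[OF rY rY]]
      represents_scale[OF represents_comp[OF rHd r3], of "1/4"] Y_relation[of d9] by simp
  then show ?thesis
    unfolding Let_def
    by (intro conjI commutator_eq_zero[OF rH rJ2] commutator_eq_zero[OF rH rJ]
      commutator_eq_zero[OF rJ2 rJ] commutator_eq_zero[OF rH rY] commutator_eq_zero[OF rH rK]
      commutator_eq_zero[OF rK rY] commutator_eq_zero[OF rJ2 rY] commutator_eq_zero[OF rJ rY]
      commutator_eq_zero[OF rJ2 rK] commutator_eq_zero[OF rJ rK])
     (simp_all add: J_square_commutes J_commutes_H J_commutes_K J_commutes_Y H_commutes_K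
       H_commutes_Y Y_K)
qed

end
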